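(* Let $\langle A,\vee\rangle$ be a join-semilattice and $c\in A$ arbitrary. Consider the maps $\mathsf{I}:\langle\theta,\delta\rangle\mapsto\langle I_\theta,I_\delta\rangle$, where $I_\theta=\{a\in A: a\,\theta\,c\}$, and $\mathsf{K}:\langle I_1,I_2\rangle\mapsto\langle\ker\pi_2,\ker\pi_1\rangle$. Then $\mathsf{I}$ and $\mathsf{K}$ are well-defined, mutually inverse maps between the set of pairs $\langle\theta,\delta\rangle$ of complementary factor congruences of $A$ and the set of pairs $\langle I_1,I_2\rangle$ of subsemilattices of $A$ such that $A=I_1\oplus_c I_2$.
   Context: A join-semilattice $\langle A,\vee\rangle$ is a set with an idempotent, commutative, associative binary operation $\vee$; it is ordered by $a\le b$ iff $a\vee b=b$. The partial operation $a\wedge b$ denotes the infimum of $\{a,b\}$ when it exists. Convention: a formula "$x\wedge y=z$" means "the infimum of $\{x,y\}$ exists and equals $z$"; any equation $t_1=t_2$ involving $\wedge$ means "if either side exists, then the other also exists and they are equal". A subsemilattice is a subset closed under $\vee$. A pair $\langle\theta,\delta\rangle$ of complementary factor congruences of $A$ is a pair of congruences that are the kernels of the two canonical projections of some direct product decomposition $A\cong A_1\times A_2$; equivalently $a\mapsto\langle a/\delta,a/\theta\rangle$ is an isomorphism $A\to A/\delta\times A/\theta$. For fixed $c\in A$, $\phi_c(x_1,x_2,x)$ is the conjunction of: (dist) $x=(x\vee x_1)\wedge(x\vee x_2)$; (p1) $x_1=(x\vee x_1)\wedge(c\vee x_1)$; (p2) $x_2=(x\vee x_2)\wedge(c\vee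 x_2)$; (join) $x_1\vee x_2=x\vee c$. For subsemilattices $I_1,I_2$, $A=I_1\oplus_c I_2$ means all of the following hold: (Mod1) for all $x,y\in A$, $x_1\in I_1$, $x_2\in I_2$: if $x\vee c\ge x_1\vee x_2$ then $((x\vee x_1)\wedge(x\vee x_2))\vee y=(x\vee y\vee x_1)\wedge(x\vee y\vee x_2)$; (Mod2) for all $x,y\in A$, $x_1\in I_1$, $x_2\in I_2$: if $x\le x_1\vee x_2$ then $((x\vee x_i)\wedge(c\vee x_i))\vee y=(x\vee y\vee x_i)\wedge(c\vee y\vee x_i)$ for $i=1,2$; (Abs) for all $x_1,y_1\in I_1$, $z_2\in I_2$: $x_1\wedge(y_1\vee z_2)=x_1\wedge(y_1\vee c)$, and likewise with $I_1,I_2$ interchanged; (exi) for all $x_1\in I_1,x_2\in I_2$ there is $x\in A$ with $\phi_c(x_1,x_2,x)$; (onto) for all $x\in A$ there are $x_1\in I_1,x_2\in I_2$ with $\phi_c(x_1,x_2,x)$. When $A=I_1\oplus_c I_2$, for each $x\in A$ there are unique $x_1\in I_1$, $x_2\in I_2$ with $\phi_c(x_1,x_2,x)$ (and $\phi_c$ gives an isomorphism $I_1\times I_2\cong A$); the projections $\pi_j:A\to I_j$ ($j=1,2$) are defined by $\pi_1(x)=x_1$, $\pi_2(x)=x_2$, i.e. $\phi_c(x_1,x_2,x)\iff \pi_1(x)=x_1$ and $\pi_2(x)=x_2$. $\ker\pi_j=\{\langle a,b\rangle\in A^2:\pi_j(a)=\pi_j(b)\}$. *)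

theory Defs
  imports "HOL-Library.Lub_Glb"
begin

section \<open>Partial infima\<close>

text \<open>
  The infimum of two elements of a join-semilattice is a partial operation, represented by an
  option. Equality of options then is exactly the required reading of equations between partial
  terms: if one side is defined then so is the other, and they are equal.
\<close>

definition pinf :: "'a::semilattice_sup \<Rightarrow> 'a \<Rightarrow> 'a option" (infix \<open>\<sqinter>\<^sub>?\<close> 60) where
  "x \<sqinter>\<^sub>? y = (if \<exists>z. isGlb UNIV {x, y} z then Some (THE z. isGlb UNIV {x, y} z) else None)"

definition psup :: "'a::semilattice_sup option \<Rightarrow> 'a \<Rightarrow> 'a option" (infix \<open>\<squnion>\<^sub>?\<close> 60) where
  "t \<squnion>\<^sub>? y = map_option (\<lambda>z. sup z y) t"

lemma isGlb_pair_iff: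
  fixes x y z :: "'a::semilattice_sup"
  shows "isGlb UNIV {x, y} z \<longleftrightarrow> z \<le> x \<and> z \<le> y \<and> (\<forall>w. w \<le> x \<and> w \<le> y \<longrightarrow> w \<le> z)"
  by (auto simp: isGlb_def isLb_def greatestP_def setle_def setge_def)

lemma pinf_eq_Some_iff: "x \<sqinter>\<^sub>? y = Some z \<longleftrightarrow> isGlb UNIV {x, y} z"
proof -
  have uniq: "u = v" if "isGlb UNIV {x, y} u" "isGlb UNIV {x, y} v" for u v
    using that by (auto simp: isGlb_pair_iff intro: order_antisym)
  have "(THE z. isGlb UNIV {x, y} z) = u" if "isGlb UNIV {x, y} u" for u
    using that by (blast intro: the_equality uniq)
  then show ?thesis
    by (auto simp: pinf_def)
qed


section \<open>Complementary factor congruences\<close>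

definition congruence :: "('a::semilattice_sup \<times> 'a) set \<Rightarrow> bool" where
  "congruence \<theta> \<longleftrightarrow> equiv UNIV \<theta> \<and>
     (\<forall>(a, a') \<in> \<theta>. \<forall>(b, b') \<in> \<theta>. (sup a b, sup a' b') \<in> \<theta>)"

text \<open>The join of two congruence classes in the quotient semilattice.\<close>

definition class_sup ::
    "('a::semilattice_sup \<times> 'a) set \<Rightarrow> 'a set \<Rightarrow> 'a set \<Rightarrow> 'a set" where
  "class_sup \<theta> X Y = (\<Union>a\<in>X. \<Union>b\<in>Y. \<theta> `` {sup a b})"

definition complementary_factor_congruences ::
    "(('a::semilattice_sup \<times> 'a) set \<times> ('a \<times> 'a) set) set" where
  "complementary_factor_congruences = {(\<theta>, \<delta>).
     congruence \<theta> \<and> congruence \<delta> \<and>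
     (let f = (\<lambda>a. (\<delta> `` {a}, \<theta> `` {a})) in
        bij_betw f UNIV ((UNIV // \<delta>) \<times> (UNIV // \<theta>)) \<and>
        (\<forall>a b. f (sup a b) =
           (class_sup \<delta> (fst (f a)) (fst (f b)), class_sup \<theta> (snd (f a)) (snd (f b)))))}"

text \<open>
  These are exactly the pairs of kernels of the projections of direct product decompositions:
  kernels_complementary holds for factors of arbitrary types; in the converse direction, the
  equivalence complementary_iff_kernels takes the factors on sets of subsets, as types cannot
  be quantified existentially.
\<close>

definition semilattice_on :: "'b set \<Rightarrow> ('b \<Rightarrow> 'b \<Rightarrow> 'b) \<Rightarrow> bool" where
  "semilattice_on B j \<longleftrightarrow>
     (\<forall>x\<in>B. \<forall>y\<in>B. j x y \<in> B) \<and>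
     (\<forall>x\<in>B. j x x = x) \<and>
     (\<forall>x\<in>B. \<forall>y\<in>B. j x y = j y x) \<and>
     (\<forall>x\<in>B. \<forall>y\<in>B. \<forall>z\<in>B. j (j x y) z = j x (j y z))"

definition product_decomposition ::
    "'b set \<Rightarrow> ('b \<Rightarrow> 'b \<Rightarrow> 'b) \<Rightarrow> 'c set \<Rightarrow> ('c \<Rightarrow> 'c \<Rightarrow> 'c) \<Rightarrow>
     ('a::semilattice_sup \<Rightarrow> 'b \<times> 'c) \<Rightarrow> bool" where
  "product_decomposition B j C k f \<longleftrightarrow>
     semilattice_on B j \<and> semilattice_on C k \<and> bij_betw f UNIV (B \<times> C) \<and>
     (\<forall>a b. f (sup a b) = (j (fst (f a)) (fst (f b)), k (snd (f a)) (snd (f b))))"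

lemma class_sup_classes:
  assumes "congruence \<theta>"
  shows "class_sup \<theta> (\<theta> `` {a}) (\<theta> `` {b}) = \<theta> `` {sup a b}"
proof -
  have e: "equiv UNIV \<theta>"
    and c: "\<And>a a' b b'. (a, a') \<in> \<theta> \<Longrightarrow> (b, b') \<in> \<theta> \<Longrightarrow> (sup a b, sup a' b') \<in> \<theta>"
    using assms by (auto simp: congruence_def)
  have "(\<lambda>a b. \<theta> `` {sup a b}) respects2 \<theta>"
    by (auto simp: congruent2_def intro!: equiv_class_eq[OF e] c)
  then show ?thesis
    unfolding class_sup_def by (rule UN_equiv_class2[OF e e]) auto
qed

lemma kernels_complementary:
  assumes "product_decomposition B j C k f"
  shows "({(a, b). snd (f a) = snd (f b)}, {(a, b). fst (f a) = fst (f b)})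
           \<in> complementary_factor_congruences"
proof -
  define \<theta> where "\<theta> = {(a, b). snd (f a) = snd (f b)}"
  define \<delta> where "\<delta> = {(a, b). fst (f a) = fst (f b)}"
  have bij: "bij_betw f UNIV (B \<times> C)"
    and hom: "\<And>a b. f (sup a b) = (j (fst (f a)) (fst (f b)), k (snd (f a)) (snd (f b)))"
    using assms by (auto simp: product_decomposition_def)
  have ct: "congruence \<theta>" and cd: "congruence \<delta>"
    by (auto simp: congruence_def \<theta>_def \<delta>_def hom equiv_def refl_on_def sym_def trans_def)
  have et: "equiv UNIV \<theta>" and ed: "equiv UNIV \<delta>"
    using ct cd by (auto simp: congruence_def)
  have bb: "bij_betw (\<lambda>a. (\<delta> `` {a}, \<theta> `` {a})) UNIV ((UNIV // \<delta>) \<times> (UNIV // \<theta>))"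
    unfolding bij_betw_def
  proof
    show "inj (\<lambda>a. (\<delta> `` {a}, \<theta> `` {a}))"
    proof (rule injI)
      fix a b assume "(\<delta> `` {a}, \<theta> `` {a}) = (\<delta> `` {b}, \<theta> `` {b})"
      then have "(a, b) \<in> \<delta>" "(a, b) \<in> \<theta>"
        using eq_equiv_class[OF _ ed] eq_equiv_class[OF _ et] by auto
      then have "f a = f b" by (auto simp: \<theta>_def \<delta>_def prod_eq_iff)
      then show "a = b" using bij by (auto simp: bij_betw_def inj_def)
    qed
    show "range (\<lambda>a. (\<delta> `` {a}, \<theta> `` {a})) = (UNIV // \<delta>) \<times> (UNIV // \<theta>)"
    proof
      show "range (\<lambda>a. (\<delta> `` {a}, \<theta> `` {a})) \<subseteq> (UNIV // \<delta>) \<times> (UNIV // \<theta>)"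
        by (auto intro: quotientI)
      show "(UNIV // \<delta>) \<times> (UNIV // \<theta>) \<subseteq> range (\<lambda>a. (\<delta> `` {a}, \<theta> `` {a}))"
      proof
        fix p assume "p \<in> (UNIV // \<delta>) \<times> (UNIV // \<theta>)"
        then obtain a b where p: "p = (\<delta> `` {a}, \<theta> `` {b})"
          by (auto elim!: quotientE)
        have "f a \<in> B \<times> C" "f b \<in> B \<times> C"
          using bij by (auto simp: bij_betw_def)
        then have "(fst (f a), snd (f b)) \<in> B \<times> C" by (auto simp: mem_Times_iff)
        then obtain d where "f d = (fst (f a), snd (f b))"
          using bij by (metis bij_betw_imp_surj_on imageE)
        then have "p = (\<delta> `` {d}, \<theta> `` {d})"
          by (auto simp: p \<theta>_def \<delta>_def)
        then show "p \<in> range (\<lambda>a. (\<delta> `` {a}, \<theta> `` {a}))" by blast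
      qed
    qed
  qed
  have "(\<theta>, \<delta>) \<in> complementary_factor_congruences"
    using ct cd bb
    by (auto simp: complementary_factor_congruences_def class_sup_classes)
  then show ?thesis by (simp add: \<theta>_def \<delta>_def)
qed

lemma semilattice_on_quotient:
  assumes "congruence \<theta>"
  shows "semilattice_on (UNIV // \<theta>) (class_sup \<theta>)"
  unfolding semilattice_on_def
proof (intro conjI ballI)
  fix X Y Z assume "X \<in> UNIV // \<theta>" "Y \<in> UNIV // \<theta>" "Z \<in> UNIV // \<theta>"
  then obtain a b d where [simp]: "X = \<theta> `` {a}" "Y = \<theta> `` {b}" "Z = \<theta> `` {d}"
    by (auto elim!: quotientE)
  show "class_sup \<theta> (class_sup \<theta> X Y) Z = class_sup \<theta> X (class_sup \<theta> Y Z)"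
    by (simp add: class_sup_classes[OF assms] sup.assoc)
next
  fix X Y assume "X \<in> UNIV // \<theta>" "Y \<in> UNIV // \<theta>"
  then obtain a b where [simp]: "X = \<theta> `` {a}" "Y = \<theta> `` {b}"
    by (auto elim!: quotientE)
  show "class_sup \<theta> X Y \<in> UNIV // \<theta>"
    by (simp add: class_sup_classes[OF assms] quotientI)
  show "class_sup \<theta> X Y = class_sup \<theta> Y X"
    by (simp add: class_sup_classes[OF assms] sup.commute)
next
  fix X assume "X \<in> UNIV // \<theta>"
  then obtain a where [simp]: "X = \<theta> `` {a}"
    by (auto elim!: quotientE)
  show "class_sup \<theta> X X = X"
    by (simp add: class_sup_classes[OF assms])
qed

lemma complementary_iff_kernels:
  fixes \<theta> \<delta> :: "('a::semilattice_sup \<times> 'a) set"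
  shows "(\<theta>, \<delta>) \<in> complementary_factor_congruences \<longleftrightarrow>
     (\<exists>(B :: 'a set set) j (C :: 'a set set) k f. product_decomposition B j C k f \<and>
        \<theta> = {(a, b). snd (f a) = snd (f b)} \<and> \<delta> = {(a, b). fst (f a) = fst (f b)})"
    (is "?L \<longleftrightarrow> ?R")
proof
  assume L: ?L
  define f where "f = (\<lambda>a. (\<delta> `` {a}, \<theta> `` {a}))"
  have ct: "congruence \<theta>" and cd: "congruence \<delta>"
    using L by (auto simp: complementary_factor_congruences_def)
  have et: "equiv UNIV \<theta>" and ed: "equiv UNIV \<delta>"
    using ct cd by (auto simp: congruence_def)
  have "product_decomposition (UNIV // \<delta>) (class_sup \<delta>) (UNIV // \<theta>) (class_sup \<theta>) f"
    using L semilattice_on_quotient[OF ct] semilattice_on_quotient[OF cd]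
    unfolding product_decomposition_def complementary_factor_congruences_def f_def Let_def
    by blast
  moreover have "\<theta> = {(a, b). snd (f a) = snd (f b)}" "\<delta> = {(a, b). fst (f a) = fst (f b)}"
    using equiv_class_eq_iff[OF et] equiv_class_eq_iff[OF ed] by (auto simp: f_def)
  ultimately show ?R by blast
next
  assume ?R
  then show ?L using kernels_complementary by blast
qed


section \<open>Decompositions into subsemilattices\<close>

definition subsemilattice :: "'a::semilattice_sup set \<Rightarrow> bool" where
  "subsemilattice I \<longleftrightarrow> (\<forall>x\<in>I. \<forall>y\<in>I. sup x y \<in> I)"

definition phi :: "'a::semilattice_sup \<Rightarrow> 'a \<Rightarrow> 'a \<Rightarrow> 'a \<Rightarrow> bool" where
  "phi c x1 x2 x \<longleftrightarrow>
     Some x = sup x x1 \<sqinter>\<^sub>? sup x x2 \<and>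
     Some x1 = sup x x1 \<sqinter>\<^sub>? sup c x1 \<and>
     Some x2 = sup x x2 \<sqinter>\<^sub>? sup c x2 \<and>
     sup x1 x2 = sup x c"

definition Mod1 :: "'a::semilattice_sup \<Rightarrow> 'a set \<Rightarrow> 'a set \<Rightarrow> bool" where
  "Mod1 c I1 I2 \<longleftrightarrow> (\<forall>x y. \<forall>x1\<in>I1. \<forall>x2\<in>I2. sup x c \<ge> sup x1 x2 \<longrightarrow>
     (sup x x1 \<sqinter>\<^sub>? sup x x2) \<squnion>\<^sub>? y = sup (sup x y) x1 \<sqinter>\<^sub>? sup (sup x y) x2)"

definition Mod2 :: "'a::semilattice_sup \<Rightarrow> 'a set \<Rightarrow> 'a set \<Rightarrow> bool" where
  "Mod2 c I1 I2 \<longleftrightarrow> (\<forall>x y. \<forall>x1\<in>I1. \<forall>x2\<in>I2. x \<le> sup x1 x2 \<longrightarrow>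
     (\<forall>xi\<in>{x1, x2}.
        (sup x xi \<sqinter>\<^sub>? sup c xi) \<squnion>\<^sub>? y = sup (sup x y) xi \<sqinter>\<^sub>? sup (sup c y) xi))"

definition Absorb :: "'a::semilattice_sup \<Rightarrow> 'a set \<Rightarrow> 'a set \<Rightarrow> bool" where
  "Absorb c I1 I2 \<longleftrightarrow>
     (\<forall>x1\<in>I1. \<forall>y1\<in>I1. \<forall>z2\<in>I2. x1 \<sqinter>\<^sub>? sup y1 z2 = x1 \<sqinter>\<^sub>? sup y1 c) \<and>
     (\<forall>x2\<in>I2. \<forall>y2\<in>I2. \<forall>z1\<in>I1. x2 \<sqinter>\<^sub>? sup y2 z1 = x2 \<sqinter>\<^sub>? sup y2 c)"

definition is_oplus :: "'a::semilattice_sup \<Rightarrow> 'a set \<Rightarrow> 'a set \<Rightarrow> bool" where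
  "is_oplus c I1 I2 \<longleftrightarrow>
     Mod1 c I1 I2 \<and> Mod2 c I1 I2 \<and> Absorb c I1 I2 \<and>
     (\<forall>x1\<in>I1. \<forall>x2\<in>I2. \<exists>x. phi c x1 x2 x) \<and>
     (\<forall>x. \<exists>x1\<in>I1. \<exists>x2\<in>I2. phi c x1 x2 x)"

definition oplus_pairs :: "'a::semilattice_sup \<Rightarrow> ('a set \<times> 'a set) set" where
  "oplus_pairs c = {(I1, I2). subsemilattice I1 \<and> subsemilattice I2 \<and> is_oplus c I1 I2}"

definition proj1 :: "'a::semilattice_sup \<Rightarrow> 'a set \<Rightarrow> 'a set \<Rightarrow> 'a \<Rightarrow> 'a" where
  "proj1 c I1 I2 x = (THE x1. x1 \<in> I1 \<and> (\<exists>x2\<in>I2. phi c x1 x2 x))"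

definition proj2 :: "'a::semilattice_sup \<Rightarrow> 'a set \<Rightarrow> 'a set \<Rightarrow> 'a \<Rightarrow> 'a" where
  "proj2 c I1 I2 x = (THE x2. x2 \<in> I2 \<and> (\<exists>x1\<in>I1. phi c x1 x2 x))"

text \<open>The projections are well-defined: the definite descriptions above denote.\<close>

lemma pinf_commute: "x \<sqinter>\<^sub>? y = y \<sqinter>\<^sub>? x"
  by (simp add: pinf_def insert_commute)

lemma phi_swap: "phi c x1 x2 x \<Longrightarrow> phi c x2 x1 x"
  unfolding phi_def by (simp only: pinf_commute sup.commute simp_thms)

lemma is_oplus_swap:
  assumes "is_oplus c I1 I2"
  shows "is_oplus c I2 I1"
proof -
  have "Mod1 c I2 I1"
    unfolding Mod1_def
  proof (intro allI ballI impI)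
    fix x y x1 x2
    assume x: "x1 \<in> I2" "x2 \<in> I1" and "sup x c \<ge> sup x1 x2"
    then have "sup x c \<ge> sup x2 x1" by (simp only: sup.commute)
    then have "(sup x x2 \<sqinter>\<^sub>? sup x x1) \<squnion>\<^sub>? y = sup (sup x y) x2 \<sqinter>\<^sub>? sup (sup x y) x1"
      using assms x unfolding is_oplus_def Mod1_def by blast
    then show "(sup x x1 \<sqinter>\<^sub>? sup x x2) \<squnion>\<^sub>? y = sup (sup x y) x1 \<sqinter>\<^sub>? sup (sup x y) x2"
      by (simp only: pinf_commute)
  qed
  moreover have "Mod2 c I2 I1"
    unfolding Mod2_def
  proof (intro allI ballI impI)
    fix x y x1 x2 xi
    assume x: "x1 \<in> I2" "x2 \<in> I1" and "x \<le> sup x1 x2" "xi \<in> {x1, x2}"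
    then have "x \<le> sup x2 x1" "xi \<in> {x2, x1}" by (simp_all only: sup.commute insert_commute)
    then show "(sup x xi \<sqinter>\<^sub>? sup c xi) \<squnion>\<^sub>? y = sup (sup x y) xi \<sqinter>\<^sub>? sup (sup c y) xi"
      using assms x unfolding is_oplus_def Mod2_def by blast
  qed
  moreover have "Absorb c I2 I1"
    using assms unfolding is_oplus_def Absorb_def by blast
  moreover have "\<forall>x1\<in>I2. \<forall>x2\<in>I1. \<exists>x. phi c x1 x2 x" "\<forall>x. \<exists>x1\<in>I2. \<exists>x2\<in>I1. phi c x1 x2 x"
    using assms phi_swap unfolding is_oplus_def by blast+
  ultimately show ?thesis
    unfolding is_oplus_def by blast
qed

lemma phi_unique1:
  assumes "is_oplus c I1 I2" "x1 \<in> I1" "x2 \<in> I2" "y1 \<in> I1" "y2 \<in> I2"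
    and x: "phi c x1 x2 x" and y: "phi c y1 y2 x"
  shows "x1 \<le> y1"
proof -
  have xg: "isGlb UNIV {sup x x1, sup x x2} x" and xj: "sup x1 x2 = sup x c"
    using x by (auto simp: phi_def simp flip: pinf_eq_Some_iff)
  have yg: "isGlb UNIV {sup x y1, sup c y1} y1" and yj: "sup y1 y2 = sup x c"
    using y by (auto simp: phi_def simp flip: pinf_eq_Some_iff)
  have abs: "x1 \<sqinter>\<^sub>? sup y1 z2 = x1 \<sqinter>\<^sub>? sup y1 c" if "z2 \<in> I2" for z2
    using assms that by (auto simp: is_oplus_def Absorb_def)
  have le_iff: "x1 \<le> w \<longleftrightarrow> x1 \<sqinter>\<^sub>? w = Some x1" for w
    by (auto simp: pinf_eq_Some_iff isGlb_pair_iff)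
  have "x1 \<le> sup y1 y2" using xj yj by (metis sup.cobounded1)
  then have 1: "x1 \<le> sup y1 c" using abs[OF \<open>y2 \<in> I2\<close>] le_iff by metis
  then have 2: "x1 \<le> sup y1 x2" using abs[OF \<open>x2 \<in> I2\<close>] le_iff by metis
  have "(sup x x1 \<sqinter>\<^sub>? sup x x2) \<squnion>\<^sub>? y1 = sup (sup x y1) x1 \<sqinter>\<^sub>? sup (sup x y1) x2"
    using assms(1-3) eq_refl[OF xj] unfolding is_oplus_def Mod1_def by blast
  moreover have "(sup x x1 \<sqinter>\<^sub>? sup x x2) \<squnion>\<^sub>? y1 = Some (sup x y1)"
    using xg by (simp add: psup_def flip: pinf_eq_Some_iff)
  ultimately have "isGlb UNIV {sup (sup x y1) x1, sup (sup x y1) x2} (sup x y1)"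
    by (simp flip: pinf_eq_Some_iff)
  moreover have "x1 \<le> sup (sup x y1) x2"
    using 2 by (simp add: sup.coboundedI2 sup.assoc)
  ultimately have "x1 \<le> sup x y1" by (simp add: isGlb_pair_iff)
  then show ?thesis using 1 yg by (simp add: isGlb_pair_iff sup.commute)
qed

lemma phi_unique:
  assumes "is_oplus c I1 I2" "x1 \<in> I1" "x2 \<in> I2" "y1 \<in> I1" "y2 \<in> I2"
    and "phi c x1 x2 x" "phi c y1 y2 x"
  shows "x1 = y1" "x2 = y2"
proof -
  show "x1 = y1"
    using phi_unique1[of c I1 I2] assms by (blast intro: order_antisym)
  show "x2 = y2"
    using phi_unique1[OF is_oplus_swap[OF assms(1)]] assms
    by (blast intro: order_antisym phi_swap)
qed

lemma phi_iff_proj: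
  assumes "is_oplus c I1 I2" "x1 \<in> I1" "x2 \<in> I2"
  shows "phi c x1 x2 x \<longleftrightarrow> proj1 c I1 I2 x = x1 \<and> proj2 c I1 I2 x = x2"
proof -
  have *: "proj1 c I1 I2 x = y1 \<and> proj2 c I1 I2 x = y2"
    if "y1 \<in> I1" "y2 \<in> I2" "phi c y1 y2 x" for y1 y2
    unfolding proj1_def proj2_def using that phi_unique[OF assms(1)]
    by (intro conjI the_equality) blast+
  moreover obtain y1 y2 where "y1 \<in> I1" "y2 \<in> I2" "phi c y1 y2 x"
    using assms(1) unfolding is_oplus_def by blast
  ultimately show ?thesis using assms by metis
qed


section \<open>The two maps\<close>

definition fun_kernel :: "('a \<Rightarrow> 'b) \<Rightarrow> ('a \<times> 'a) set" where
  "fun_kernel f = {(a, b). f a = f b}"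

definition I_map :: "'a::semilattice_sup \<Rightarrow> ('a \<times> 'a) set \<times> ('a \<times> 'a) set \<Rightarrow> 'a set \<times> 'a set" where
  "I_map c = (\<lambda>(\<theta>, \<delta>). ({a. (a, c) \<in> \<theta>}, {a. (a, c) \<in> \<delta>}))"

definition K_map :: "'a::semilattice_sup \<Rightarrow> 'a set \<times> 'a set \<Rightarrow> ('a \<times> 'a) set \<times> ('a \<times> 'a) set" where
  "K_map c = (\<lambda>(I1, I2). (fun_kernel (proj2 c I1 I2), fun_kernel (proj1 c I1 I2)))"

end

(*
  Under A = A1 x A2 the subsemilattices are I1 = A1 x {c2} and I2 = {c1} x A2, and phi_c says that
  (p, q) has components (p, c2) and (c1, q). Every infimum in (Mod1), (Mod2) and phi_c is of two
  elements that are comparable in opposite directions in the two coordinates, so it exists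
  and joins distribute over it.

  Conversely, phi_c is compatible with joins: write z = x v y and z_i = x_i v y_i. Joining the
  infima for x and y with suitable elements, (Mod1) gives
  z = inf {z v x_i v y_j | i, j = 1, 2}. The mixed terms lie above c by (exi), hence above all
  the others, and drop out. (Mod2) yields the two projection formulas in the same way.
*)
theory Submission
  imports Defs
begin

section \<open>From factor congruences to subsemilattices\<close>

text \<open>Only the kernels of \<open>p\<close> and \<open>q\<close> matter, so the codomains carry
  no semilattice structure: \<open>p (sup a b) = p b\<close> serves as the inequality between
  \<open>a\<close> and \<open>b\<close> in the first coordinate. The conditions are symmetric, so
  dual halves follow by exchanging \<open>p\<close> and \<open>q\<close>.\<close>

locale product_projections =
  fixes p :: "'a::semilattice_sup \<Rightarrow> 'b" and q :: "'a \<Rightarrow> 'c"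
  assumes p_cong: "p a = p a' \<Longrightarrow> p b = p b' \<Longrightarrow> p (sup a b) = p (sup a' b')"
    and q_cong: "q a = q a' \<Longrightarrow> q b = q b' \<Longrightarrow> q (sup a b) = q (sup a' b')"
    and pq_inj: "p a = p b \<Longrightarrow> q a = q b \<Longrightarrow> a = b"
    and pq_surj: "\<exists>d. p d = p a \<and> q d = q b"
begin

lemma swap: "product_projections q p"
  using p_cong q_cong pq_inj pq_surj unfolding product_projections_def by metis

text \<open>The last two assumptions put \<open>u\<close> below \<open>v\<close> in the first
  coordinate and \<open>v\<close> below \<open>u\<close> in the second, so the coordinatewise
  minimum is \<open>(p u, q v)\<close>, which \<open>w\<close> realizes. Each inequality is checked
  in both coordinates and lifted by \<open>pq_inj\<close>.\<close>

lemma pinf_crosswise: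
  assumes "p w = p u" "q w = q v" "p (sup u v) = p v" "q (sup u v) = q u"
  shows "u \<sqinter>\<^sub>? v = Some w"
proof -
  have "sup w u = u"
  proof (rule pq_inj)
    show "p (sup w u) = p u" using p_cong[OF assms(1) refl, of u] by simp
    show "q (sup w u) = q u" using q_cong[OF assms(2) refl, of u] assms(4) by (simp add: sup.commute)
  qed
  moreover have "sup w v = v"
  proof (rule pq_inj)
    show "p (sup w v) = p v" using p_cong[OF assms(1) refl, of v] assms(3) by simp
    show "q (sup w v) = q v" using q_cong[OF assms(2) refl, of v] by simp
  qed
  moreover have "t \<le> w" if "t \<le> u" "t \<le> v" for t
  proof -
    have "sup t w = w"
    proof (rule pq_inj)
      show "p (sup t w) = p w"
        using p_cong[OF refl assms(1), of t] that(1) assms(1) by (simp add: sup_absorb2)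
      show "q (sup t w) = q w"
        using q_cong[OF refl assms(2), of t] that(2) assms(2) by (simp add: sup_absorb2)
    qed
    then show ?thesis by (simp add: le_iff_sup)
  qed
  ultimately show ?thesis by (simp add: pinf_eq_Some_iff isGlb_pair_iff le_iff_sup)
qed

text \<open>Joining with \<open>y\<close> preserves both coordinatewise comparisons, so
  \<open>sup w y\<close> is again a crosswise infimum.\<close>

lemma psup_crosswise:
  assumes "p (sup u v) = p v" "q (sup u v) = q u"
  shows "(u \<sqinter>\<^sub>? v) \<squnion>\<^sub>? y = sup u y \<sqinter>\<^sub>? sup v y"
proof -
  obtain w where w: "p w = p u" "q w = q v" using pq_surj by blast
  have "sup (sup u y) (sup v y) = sup (sup u v) y" by (simp add: ac_simps)
  then have "sup u y \<sqinter>\<^sub>? sup v y = Some (sup w y)"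
    using w assms by (intro pinf_crosswise) (auto intro: p_cong q_cong)
  then show ?thesis using pinf_crosswise[OF w assms] by (simp add: psup_def)
qed

lemma phiI:
  assumes "p x1 = p x" "q x1 = q c" "p x2 = p c" "q x2 = q x"
  shows "phi c x1 x2 x"
proof -
  have 1: "p (sup x x1) = p x" "p (sup x x2) = p (sup x c)" "p (sup c x1) = p (sup x c)" "p (sup c x2) = p c"
    using p_cong[of x x x1 x] p_cong[of x x x2 c] p_cong[of c c x1 x] p_cong[of c c x2 c] assms
    by (simp_all add: sup.commute)
  have 2: "q (sup x x1) = q (sup x c)" "q (sup x x2) = q x" "q (sup c x1) = q c" "q (sup c x2) = q (sup x c)"
    using q_cong[of x x x1 c] q_cong[of x x x2 x] q_cong[of c c x1 c] q_cong[of c c x2 x] assms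
    by (simp_all add: sup.commute)
  note 3 = p_cong[OF 1(1) 1(2)] q_cong[OF 2(1) 2(2)] p_cong[OF 1(1) 1(3)] q_cong[OF 2(1) 2(3)]
    p_cong[OF 1(4) 1(2)] q_cong[OF 2(4) 2(2)]
  have "sup x x1 \<sqinter>\<^sub>? sup x x2 = Some x"
    by (rule pinf_crosswise) (simp_all only: 1 2 3, simp_all add: ac_simps)
  moreover have "sup x x1 \<sqinter>\<^sub>? sup c x1 = Some x1"
    by (rule pinf_crosswise) (simp_all only: 1 2 3 assms, simp_all add: ac_simps)
  \<comment> \<open>The arguments are exchanged because \<open>pinf_crosswise\<close> wants the one
    with the smaller first coordinate in front: \<open>sup c x2\<close> has that of
    \<open>c\<close>, \<open>sup x x2\<close> that of \<open>sup x c\<close>.\<close>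
  moreover have "sup c x2 \<sqinter>\<^sub>? sup x x2 = Some x2"
    by (rule pinf_crosswise) (simp_all only: 1 2 3 assms, simp_all add: ac_simps)
  moreover have "sup x1 x2 = sup x c"
    using p_cong[of x1 x x2 c] q_cong[of x1 c x2 x] assms
    by (intro pq_inj) (simp_all add: sup.commute)
  ultimately show ?thesis by (simp add: phi_def pinf_commute)
qed

section \<open>The decomposition conditions for the classes of \<open>c\<close>\<close>

lemma Mod1: "Mod1 c {a. q a = q c} {a. p a = p c}"
  unfolding Mod1_def
proof (intro allI ballI impI, unfold mem_Collect_eq)
  fix x y x1 x2 assume 1: "q x1 = q c" "p x2 = p c" "sup x1 x2 \<le> sup x c"
  have e: "sup (sup x x1) (sup x x2) = sup (sup x x1) x2"
    "sup (sup x x1) (sup x x2) = sup (sup x x2) x1"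
    by (simp_all add: ac_simps)
  \<comment> \<open>By the hypothesis \<open>x1\<close> and \<open>x2\<close> are absorbed by
    \<open>sup x c\<close>. The first coordinate does not distinguish \<open>x2\<close> from
    \<open>c\<close>, nor the second \<open>x1\<close> from \<open>c\<close>, so these equations
    yield the crosswise comparison.\<close>
  have "sup (sup x x1) c = sup x c" "sup (sup x x2) c = sup x c"
    using 1(3) by (auto intro!: order_antisym simp: le_supI1)
  then have "p (sup (sup x x1) (sup x x2)) = p (sup x x2)"
    "q (sup (sup x x1) (sup x x2)) = q (sup x x1)"
    using p_cong[OF refl 1(2)] q_cong[OF refl 1(1)] by (simp add: e(1), simp add: e(2))
  from psup_crosswise[OF this]
  show "(sup x x1 \<sqinter>\<^sub>? sup x x2) \<squnion>\<^sub>? y = sup (sup x y) x1 \<sqinter>\<^sub>? sup (sup x y) x2"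
    by (simp add: ac_simps)
qed

text \<open>In the first coordinate \<open>c\<close> may be traded for \<open>x2\<close>, and then
  \<open>x\<close> is absorbed by \<open>sup x1 x2\<close>; in the second, \<open>c\<close> may be
  traded for \<open>x1\<close>. So \<open>sup x x1\<close> and \<open>sup c x1\<close> are
  comparable crosswise.\<close>

lemma Mod2_half:
  assumes "q x1 = q c" "p x2 = p c" "x \<le> sup x1 x2"
  shows "(sup x x1 \<sqinter>\<^sub>? sup c x1) \<squnion>\<^sub>? y = sup (sup x y) x1 \<sqinter>\<^sub>? sup (sup c y) x1"
proof -
  have "p (sup (sup x x1) (sup c x1)) = p (sup (sup x x1) x2)"
    using p_cong[OF refl assms(2)[symmetric], of "sup x x1"] by (simp add: ac_simps)
  also have "sup (sup x x1) x2 = sup x1 x2"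
    using assms(3) by (simp add: sup.assoc sup_absorb2)
  also have "p (sup x1 x2) = p (sup c x1)"
    using p_cong[OF refl assms(2), of x1] by (simp add: sup.commute)
  finally have P: "p (sup (sup x x1) (sup c x1)) = p (sup c x1)" .
  have "q (sup (sup x x1) (sup c x1)) = q (sup (sup x x1) (sup x1 x1))"
    using assms(1) by (intro q_cong) auto
  then have "q (sup (sup x x1) (sup c x1)) = q (sup x x1)" by (simp add: sup.assoc)
  from psup_crosswise[OF P this] show ?thesis by (simp add: ac_simps)
qed

text \<open>The infima need not exist, so lower bounds are compared. For \<open>t \<le> x1\<close>
  both bounds on \<open>t\<close> hold automatically in the second coordinate, where
  \<open>x1\<close>, \<open>y1\<close> and \<open>c\<close> agree; in the first they coincide, since
  \<open>z2\<close> and \<open>c\<close> agree there.\<close>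

lemma Absorb_half:
  assumes "q x1 = q c" "q y1 = q c" "p z2 = p c"
  shows "x1 \<sqinter>\<^sub>? sup y1 z2 = x1 \<sqinter>\<^sub>? sup y1 c"
proof -
  have P: "p (sup t (sup y1 z2)) = p (sup t (sup y1 c))" "p (sup y1 z2) = p (sup y1 c)" for t
    using assms by (auto intro: p_cong)
  have "t \<le> sup y1 z2 \<longleftrightarrow> t \<le> sup y1 c" if "t \<le> x1" for t
  proof -
    have "q (sup t c) = q c"
      using q_cong[OF refl assms(1), of t] that assms(1) by (simp add: sup_absorb2)
    moreover have "q (sup t (sup y1 z2)) = q (sup (sup t c) z2)"
      "q (sup y1 z2) = q (sup c z2)" "q (sup t (sup y1 c)) = q (sup t c)"
      "q (sup y1 c) = q c"
      using assms(2) q_cong[of y1 c] q_cong[of t t "sup y1 c" c] q_cong[of "sup t y1" "sup t c" z2 z2]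
        q_cong[of t t y1 c] by (auto simp: sup.assoc)
    ultimately have "q (sup t (sup y1 z2)) = q (sup y1 z2)" "q (sup t (sup y1 c)) = q (sup y1 c)"
      using q_cong[of "sup t c" c z2 z2] by simp_all
    then show ?thesis using P pq_inj by (metis le_iff_sup)
  qed
  then have "isGlb UNIV {x1, sup y1 z2} = isGlb UNIV {x1, sup y1 c}"
    by (intro ext) (auto simp: isGlb_pair_iff)
  then show ?thesis by (simp add: pinf_def)
qed

lemma oplus_classes: "({a. q a = q c}, {a. p a = p c}) \<in> oplus_pairs c"
proof -
  interpret sw: product_projections q p by (rule swap)
  have "Mod2 c {a. q a = q c} {a. p a = p c}"
    unfolding Mod2_def
  proof (intro allI ballI impI, unfold mem_Collect_eq)
    fix x y x1 x2 xi
    assume "q x1 = q c" "p x2 = p c" "x \<le> sup x1 x2" "xi \<in> {x1, x2}"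
    then show "(sup x xi \<sqinter>\<^sub>? sup c xi) \<squnion>\<^sub>? y = sup (sup x y) xi \<sqinter>\<^sub>? sup (sup c y) xi"
      using Mod2_half[of x1 c x2 x] sw.Mod2_half[of x2 c x1 x] sup.commute[of x1 x2] by auto
  qed
  moreover have "Absorb c {a. q a = q c} {a. p a = p c}"
    unfolding Absorb_def by (intro conjI ballI Absorb_half sw.Absorb_half; simp)
  moreover have "\<forall>x1\<in>{a. q a = q c}. \<forall>x2\<in>{a. p a = p c}. \<exists>x. phi c x1 x2 x"
  proof (intro ballI, unfold mem_Collect_eq)
    fix x1 x2 assume x: "q x1 = q c" "p x2 = p c"
    obtain x where "p x = p x1" "q x = q x2" using pq_surj by blast
    then show "\<exists>x. phi c x1 x2 x" using phiI[of x1 x c x2] x by force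
  qed
  moreover have "\<forall>x. \<exists>x1\<in>{a. q a = q c}. \<exists>x2\<in>{a. p a = p c}. phi c x1 x2 x"
  proof
    fix x
    obtain x1 x2 where "p x1 = p x" "q x1 = q c" "p x2 = p c" "q x2 = q x"
      using pq_surj by metis
    then show "\<exists>x1\<in>{a. q a = q c}. \<exists>x2\<in>{a. p a = p c}. phi c x1 x2 x"
      using phiI by blast
  qed
  ultimately have "is_oplus c {a. q a = q c} {a. p a = p c}"
    unfolding is_oplus_def by (intro conjI Mod1)
  moreover have "subsemilattice {a. q a = q c}" "subsemilattice {a. p a = p c}"
    unfolding subsemilattice_def mem_Collect_eq Ball_def
    using p_cong[where a' = c and b' = c] q_cong[where a' = c and b' = c] unfolding sup.idem
    by blast+
  ultimately show ?thesis by (simp add: oplus_pairs_def)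
qed

section \<open>Recovering the congruences\<close>

lemma K_map_classes:
  "K_map c ({a. q a = q c}, {a. p a = p c}) = (fun_kernel q, fun_kernel p)"
proof -
  let ?I1 = "{a. q a = q c}" and ?I2 = "{a. p a = p c}"
  have o: "is_oplus c ?I1 ?I2" using oplus_classes by (simp add: oplus_pairs_def)
  \<comment> \<open>Each projection keeps one coordinate of \<open>x\<close> and fixes the other at
    that of \<open>c\<close>, so its kernel is the kernel of the coordinate kept.\<close>
  have *: "p (proj1 c ?I1 ?I2 x) = p x \<and> q (proj1 c ?I1 ?I2 x) = q c \<and>
    p (proj2 c ?I1 ?I2 x) = p c \<and> q (proj2 c ?I1 ?I2 x) = q x" for x
  proof -
    obtain x1 x2 where x: "p x1 = p x" "q x1 = q c" "p x2 = p c" "q x2 = q x"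
      using pq_surj by metis
    then show ?thesis using phiI[OF x] phi_iff_proj[OF o, of x1 x2 x] by simp
  qed
  have "fun_kernel (proj1 c ?I1 ?I2) = fun_kernel p" "fun_kernel (proj2 c ?I1 ?I2) = fun_kernel q"
    unfolding fun_kernel_def using * pq_inj by (metis (no_types, lifting))+
  then show ?thesis by (simp add: K_map_def)
qed

end

text \<open>The indices cross: \<open>\<theta>\<close> is the kernel of the second coordinate, so
  its class of \<open>c\<close> is a copy of the first factor.\<close>

lemma complementary_factor_congruences_cases:
  assumes "(\<theta>, \<delta>) \<in> complementary_factor_congruences"
  obtains p q :: "'a::semilattice_sup \<Rightarrow> 'a set"
  where "product_projections p q" "\<theta> = fun_kernel q" "\<delta> = fun_kernel p"
proof -
  obtain B :: "'a set set" and j and C :: "'a set set" and k f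
    where d: "product_decomposition B j C k f"
      and k: "\<theta> = {(a, b). snd (f a) = snd (f b)}" "\<delta> = {(a, b). fst (f a) = fst (f b)}"
    using assms unfolding complementary_iff_kernels by blast
  have bij: "bij_betw f UNIV (B \<times> C)"
    and hom: "\<And>a b. f (sup a b) = (j (fst (f a)) (fst (f b)), k (snd (f a)) (snd (f b)))"
    using d by (auto simp: product_decomposition_def)
  have "product_projections (fst \<circ> f) (snd \<circ> f)"
  proof
    fix a b
    show "a = b" if "(fst \<circ> f) a = (fst \<circ> f) b" "(snd \<circ> f) a = (snd \<circ> f) b"
      using that bij by (auto simp: bij_betw_def inj_def prod_eq_iff)
    have "f t \<in> B \<times> C" for t
      using bij by (auto simp: bij_betw_def)
    then have "(fst (f a), snd (f b)) \<in> range f"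
      using bij by (simp add: bij_betw_def mem_Times_iff)
    then obtain d where "f d = (fst (f a), snd (f b))" by (metis imageE)
    then show "\<exists>d. (fst \<circ> f) d = (fst \<circ> f) a \<and> (snd \<circ> f) d = (snd \<circ> f) b"
      by (intro exI[of _ d]) simp
  qed (simp_all add: hom)
  then show thesis using that k by (simp add: fun_kernel_def)
qed


section \<open>From subsemilattices to factor congruences\<close>

context
  fixes c :: "'a::semilattice_sup" and I1 I2
  assumes oplus: "is_oplus c I1 I2"
begin

lemma sup_ge_centre:
  assumes "x1 \<in> I1" "x2 \<in> I2"
  shows "c \<le> sup x1 x2"
  using oplus assms unfolding is_oplus_def phi_def by (metis sup.cobounded2)

text \<open>The equation for \<open>x\<close> joined with \<open>y\<close> by (Mod1), whose premise
  holds because \<open>sup x1 x2 = sup x c\<close>. Stated as a bound on \<open>w\<close>, it can be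
  applied repeatedly to eliminate components.\<close>

lemma phi_dist_sup:
  assumes "x1 \<in> I1" "x2 \<in> I2" "phi c x1 x2 x"
    and "w \<le> sup (sup x y) x1" "w \<le> sup (sup x y) x2"
  shows "w \<le> sup x y"
proof -
  have "sup x x1 \<sqinter>\<^sub>? sup x x2 = Some x" and j: "sup x1 x2 = sup x c"
    using assms(3) by (auto simp: phi_def)
  moreover have "(sup x x1 \<sqinter>\<^sub>? sup x x2) \<squnion>\<^sub>? y = sup (sup x y) x1 \<sqinter>\<^sub>? sup (sup x y) x2"
    using oplus assms(1,2) eq_refl[OF j] unfolding is_oplus_def Mod1_def by blast
  ultimately have "sup (sup x y) x1 \<sqinter>\<^sub>? sup (sup x y) x2 = Some (sup x y)"
    by (simp add: psup_def)
  then show ?thesis using assms by (simp add: pinf_eq_Some_iff isGlb_pair_iff)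
qed

text \<open>The analogue for the equation defining \<open>x1\<close>, by (Mod2).\<close>

lemma phi_proj_sup:
  assumes "x1 \<in> I1" "x2 \<in> I2" "phi c x1 x2 x"
    and "w \<le> sup (sup x y) x1" "w \<le> sup (sup c y) x1"
  shows "w \<le> sup x1 y"
proof -
  have "sup x x1 \<sqinter>\<^sub>? sup c x1 = Some x1" and j: "sup x1 x2 = sup x c"
    using assms(3) by (auto simp: phi_def)
  moreover from j have "x \<le> sup x1 x2" by simp
  then have "(sup x x1 \<sqinter>\<^sub>? sup c x1) \<squnion>\<^sub>? y = sup (sup x y) x1 \<sqinter>\<^sub>? sup (sup c y) x1"
    using oplus assms(1,2) unfolding is_oplus_def Mod2_def by blast
  ultimately have "sup (sup x y) x1 \<sqinter>\<^sub>? sup (sup c y) x1 = Some (sup x1 y)"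
    by (simp add: psup_def)
  then show ?thesis using assms by (simp add: pinf_eq_Some_iff isGlb_pair_iff)
qed

lemma phi_sup_dist:
  assumes x: "x1 \<in> I1" "x2 \<in> I2" "phi c x1 x2 x" and y: "y1 \<in> I1" "y2 \<in> I2" "phi c y1 y2 y"
  shows "sup (sup x y) (sup x1 y1) \<sqinter>\<^sub>? sup (sup x y) (sup x2 y2) = Some (sup x y)"
proof -
  have "w \<le> sup x y" if w: "w \<le> sup (sup x y) (sup x1 y1)" "w \<le> sup (sup x y) (sup x2 y2)" for w
  proof -
    have "sup x1 x2 = sup x c" "sup y1 y2 = sup y c"
      using x y by (auto simp: phi_def)
    then have le: "x1 \<le> sup x c" "y1 \<le> sup y c"
      by (metis sup.cobounded1)+
    have "sup x c \<le> sup (sup x y) c" "sup y c \<le> sup (sup x y) c"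
      by (simp_all add: le_supI1)
    then have "x1 \<le> sup (sup x y) c" "y1 \<le> sup (sup x y) c"
      using le by (auto intro: order_trans)
    then have "sup (sup x y) (sup x1 y1) \<le> sup (sup x y) c" by simp
    then have wc: "w \<le> sup (sup x y) c" using w(1) by (rule order_trans[rotated])
    \<comment> \<open>A join of components of different elements still lies above \<open>c\<close>,
      so the bound \<open>wc\<close> passes to it.\<close>
    have 12: "w \<le> sup (sup x y) (sup x1 y2)"
      using order_trans[OF wc sup.mono[OF order_refl sup_ge_centre[OF x(1) y(2)]]] .
    have 21: "w \<le> sup (sup x y) (sup y1 x2)"
      using order_trans[OF wc sup.mono[OF order_refl sup_ge_centre[OF y(1) x(2)]]] .
    \<comment> \<open>The decomposition of \<open>y\<close> eliminates \<open>y1\<close> and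
      \<open>y2\<close>, once beside \<open>x1\<close> and once beside \<open>x2\<close>; that of
      \<open>x\<close> then eliminates \<open>x1\<close> and \<open>x2\<close>.\<close>
    have "w \<le> sup y (sup x x1)"
      using w(1) 12 by (intro phi_dist_sup[OF y]) (simp_all add: ac_simps)
    moreover have "w \<le> sup y (sup x x2)"
      using w(2) 21 by (intro phi_dist_sup[OF y]) (simp_all add: ac_simps)
    ultimately show ?thesis
      by (intro phi_dist_sup[OF x]) (simp_all add: ac_simps)
  qed
  then show ?thesis by (simp add: pinf_eq_Some_iff isGlb_pair_iff)
qed

lemma phi_sup_proj:
  assumes x: "x1 \<in> I1" "x2 \<in> I2" "phi c x1 x2 x" and y: "y1 \<in> I1" "y2 \<in> I2" "phi c y1 y2 y"
  shows "sup (sup x y) (sup x1 y1) \<sqinter>\<^sub>? sup c (sup x1 y1) = Some (sup x1 y1)"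
proof -
  have "w \<le> sup x1 y1" if w: "w \<le> sup (sup x y) (sup x1 y1)" "w \<le> sup c (sup x1 y1)" for w
  proof -
    \<comment> \<open>Weakening the second bound by \<open>y\<close> matches the shape needed to
      eliminate \<open>x\<close>; the unweakened bound then serves to eliminate
      \<open>y\<close>.\<close>
    have "sup c (sup x1 y1) \<le> sup y (sup c (sup x1 y1))" by simp
    with w(2) have "w \<le> sup y (sup c (sup x1 y1))" by (rule order_trans)
    then have "w \<le> sup x1 (sup y y1)"
      using w(1) by (intro phi_proj_sup[OF x]) (simp_all add: ac_simps)
    then have "w \<le> sup y1 x1"
      using w(2) by (intro phi_proj_sup[OF y]) (simp_all add: ac_simps)
    then show ?thesis by (simp add: sup.commute)
  qed
  then show ?thesis by (simp add: pinf_eq_Some_iff isGlb_pair_iff)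
qed

end

text \<open>Gives injectivity. The join condition yields \<open>y \<le> sup c x\<close>; the
  projection equations of \<open>y\<close> replace \<open>c\<close> by \<open>x1\<close> and by
  \<open>x2\<close>, and distributivity for \<open>x\<close> removes these.\<close>

lemma phi_determines_le:
  assumes o: "is_oplus c I1 I2" and I: "x1 \<in> I1" "x2 \<in> I2" and x: "phi c x1 x2 x" and y: "phi c x1 x2 y"
  shows "y \<le> x"
proof -
  have "sup x1 x2 = sup x c" "sup x1 x2 = sup y c" using x y by (auto simp: phi_def)
  then have "y \<le> sup c x" by (metis sup.cobounded1 sup.commute)
  then have "y \<le> sup x1 x" "y \<le> sup x2 x"
    using phi_proj_sup[OF o I y, of y x] phi_proj_sup[OF is_oplus_swap[OF o] I(2,1) phi_swap[OF y], of y x]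
    by (simp_all add: le_supI1)
  then show ?thesis
    using phi_dist_sup[OF o I x, of y x] by (simp add: sup.commute)
qed

lemma phi_sup:
  assumes o: "is_oplus c I1 I2"
    and x: "x1 \<in> I1" "x2 \<in> I2" "phi c x1 x2 x" and y: "y1 \<in> I1" "y2 \<in> I2" "phi c y1 y2 y"
  shows "phi c (sup x1 y1) (sup x2 y2) (sup x y)"
proof -
  have "sup x1 x2 = sup x c" "sup y1 y2 = sup y c"
    using x y by (auto simp: phi_def)
  moreover have "sup (sup x1 y1) (sup x2 y2) = sup (sup x1 x2) (sup y1 y2)"
    by (simp add: ac_simps)
  ultimately have "sup (sup x1 y1) (sup x2 y2) = sup (sup x y) c"
    by (simp add: ac_simps)
  moreover note phi_sup_dist[OF o x y] phi_sup_proj[OF o x y]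
    phi_sup_proj[OF is_oplus_swap[OF o] x(2,1) phi_swap[OF x(3)] y(2,1) phi_swap[OF y(3)]]
  ultimately show ?thesis by (simp add: phi_def)
qed

lemma phi_projs:
  assumes "is_oplus c I1 I2"
  shows "proj1 c I1 I2 x \<in> I1" "proj2 c I1 I2 x \<in> I2" "phi c (proj1 c I1 I2 x) (proj2 c I1 I2 x) x"
proof -
  obtain x1 x2 where "x1 \<in> I1" "x2 \<in> I2" "phi c x1 x2 x"
    using assms unfolding is_oplus_def by blast
  then show "proj1 c I1 I2 x \<in> I1" "proj2 c I1 I2 x \<in> I2"
    "phi c (proj1 c I1 I2 x) (proj2 c I1 I2 x) x"
    using phi_iff_proj[OF assms] by auto
qed

section \<open>The projections as a product decomposition\<close>

lemma product_decomposition_projs: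
  assumes s: "subsemilattice I1" "subsemilattice I2" and o: "is_oplus c I1 I2"
  shows "product_decomposition I1 sup I2 sup (\<lambda>x. (proj1 c I1 I2 x, proj2 c I1 I2 x))"
    (is "product_decomposition _ _ _ _ ?f")
  unfolding product_decomposition_def
proof (intro conjI allI)
  show "semilattice_on I1 sup" "semilattice_on I2 sup"
    using s by (auto simp: semilattice_on_def subsemilattice_def ac_simps)
  show "bij_betw ?f UNIV (I1 \<times> I2)"
  proof (intro bij_betw_imageI injI)
    fix x y assume "?f x = ?f y"
    then show "x = y"
      using phi_determines_le[OF o] phi_projs[OF o] by (metis order_antisym prod.inject)
  next
    have "p \<in> range ?f" if p: "p \<in> I1 \<times> I2" for p
    proof -
      obtain x where "phi c (fst p) (snd p) x"
        using o p unfolding is_oplus_def by (metis mem_Times_iff)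
      then have "?f x = p" using that phi_iff_proj[OF o, of "fst p" "snd p" x] by auto
      then show ?thesis by blast
    qed
    then show "range ?f = I1 \<times> I2" using phi_projs[OF o] by auto
  qed
  fix a b
  \<comment> \<open>\<open>phi_sup\<close> gives components of \<open>sup a b\<close>; closure under
    joins puts them in \<open>I1\<close> and \<open>I2\<close>, so uniqueness makes them the
    projections.\<close>
  show "?f (sup a b) = (sup (fst (?f a)) (fst (?f b)), sup (snd (?f a)) (snd (?f b)))"
    using phi_sup[OF o phi_projs[OF o] phi_projs[OF o], of a b]
      phi_projs[OF o, of a] phi_projs[OF o, of b] s phi_iff_proj[OF o]
    by (simp add: subsemilattice_def)
qed

lemma K_map_complementary:
  assumes "(I1, I2) \<in> oplus_pairs c"
  shows "K_map c (I1, I2) \<in> complementary_factor_congruences"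
  using assms kernels_complementary[OF product_decomposition_projs[of I1 I2 c]]
  by (simp add: oplus_pairs_def K_map_def fun_kernel_def)

section \<open>Recovering the subsemilattices\<close>

lemma phi_centre:
  assumes "phi c x1 x2 c"
  shows "x1 = c"
proof -
  have "sup x1 x2 = c" using assms by (simp add: phi_def)
  then have "sup c x1 = c" by (metis sup.commute sup.left_idem)
  \<comment> \<open>At \<open>x = c\<close> both arguments of the infimum defining \<open>x1\<close>
    are \<open>sup c x1\<close>.\<close>
  moreover have "isGlb UNIV {sup c x1, sup c x1} x1"
    using assms unfolding phi_def by (metis insert_absorb2 pinf_eq_Some_iff sup.idem)
  ultimately show ?thesis by (auto simp only: isGlb_pair_iff intro: order_antisym)
qed

text \<open>Identifies the components of an element of \<open>I1\<close>. In each infimum one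
  argument lies below the other.\<close>

lemma phi_self: "phi c a c a"
  by (auto simp: phi_def eq_commute[of "Some _"] pinf_eq_Some_iff isGlb_pair_iff sup.commute)

text \<open>The join condition turns \<open>sup c x1\<close> into \<open>sup a c\<close>, so
  \<open>a\<close> and \<open>x1\<close> are infima of the same pair.\<close>

lemma phi_centre_right:
  assumes "phi c x1 c a"
  shows "x1 = a"
proof -
  have "sup c x1 = sup a c" "sup a x1 \<sqinter>\<^sub>? sup a c = Some a" "sup a x1 \<sqinter>\<^sub>? sup c x1 = Some x1"
    using assms by (auto simp: phi_def sup.commute)
  then show ?thesis by simp
qed

text \<open>The centre is its own second projection, hence lies in \<open>I2\<close>. Elements of
  \<open>I1\<close> therefore have second projection \<open>c\<close> by \<open>phi_self\<close>;
  conversely, second projection \<open>c\<close> forces an element to equal its first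
  projection.\<close>

lemma proj2_kernel_class:
  assumes o: "is_oplus c I1 I2"
  shows "{a. proj2 c I1 I2 a = proj2 c I1 I2 c} = I1"
proof -
  have c2: "proj2 c I1 I2 c = c"
    using phi_centre[OF phi_swap[OF phi_projs(3)[OF o, of c]]] .
  then have "c \<in> I2" using phi_projs(2)[OF o, of c] by simp
  have *: "proj2 c I1 I2 a = c \<longleftrightarrow> a \<in> I1" for a
  proof
    show "proj2 c I1 I2 a = c" if "a \<in> I1"
      using phi_iff_proj[OF o that \<open>c \<in> I2\<close>] phi_self by blast
    show "a \<in> I1" if "proj2 c I1 I2 a = c"
      using phi_projs[OF o, of a] phi_centre_right that by metis
  qed
  show ?thesis unfolding c2 * by simp
qed

lemma proj1_swap:
  assumes "is_oplus c I1 I2"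
  shows "proj2 c I2 I1 = proj1 c I1 I2"
proof
  fix x
  show "proj2 c I2 I1 x = proj1 c I1 I2 x"
    using phi_iff_proj[OF is_oplus_swap[OF assms] phi_projs(2,1)[OF assms]] phi_swap[OF phi_projs(3)[OF assms]]
    by blast
qed

lemma I_map_K_map:
  assumes "(I1, I2) \<in> oplus_pairs c"
  shows "I_map c (K_map c (I1, I2)) = (I1, I2)"
proof -
  have o: "is_oplus c I1 I2" using assms by (simp add: oplus_pairs_def)
  show ?thesis
    using proj2_kernel_class[OF o] proj2_kernel_class[OF is_oplus_swap[OF o]]
    by (simp add: I_map_def K_map_def fun_kernel_def proj1_swap[OF o])
qed

theorem theorem1:
  fixes c :: "'a::semilattice_sup"
  shows "I_map c ` complementary_factor_congruences \<subseteq> oplus_pairs c \<and>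
         K_map c ` oplus_pairs c \<subseteq> complementary_factor_congruences \<and>
         (\<forall>p \<in> complementary_factor_congruences. K_map c (I_map c p) = p) \<and>
         (\<forall>q \<in> oplus_pairs c. I_map c (K_map c q) = q)"
proof -
  have "I_map c p \<in> oplus_pairs c \<and> K_map c (I_map c p) = p"
    if comp: "p \<in> complementary_factor_congruences" for p
  proof -
    obtain \<theta> \<delta> where p: "p = (\<theta>, \<delta>)" by fastforce
    obtain f g :: "'a \<Rightarrow> 'a set"
      where pp: "product_projections f g" and k: "\<theta> = fun_kernel g" "\<delta> = fun_kernel f"
      using complementary_factor_congruences_cases comp unfolding p by blast
    have "I_map c p = ({a. g a = g c}, {a. f a = f c})"
      by (simp add: p k I_map_def fun_kernel_def)
    then show ?thesis
      using product_projections.oplus_classes[OF pp] product_projections.K_map_classes[OF pp]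
      by (simp add: p k)
  qed
  then show ?thesis using K_map_complementary I_map_K_map by auto
qed

end
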